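(* Let $n\ge 1$, let $\mathcal{F}_n^{\alpha,\beta}=\{\varphi_{n,i}\}_{i=0}^n$ with $\varphi_{n,0}\equiv 1$ be an extended Chebyshev (EC) system on $[\alpha,\beta]$ with span $\mathbb{S}_n^{\alpha,\beta}$, and let $\mathcal{B}_n^{\alpha,\beta}=\{b_{n,i}\}_{i=0}^n$ be the normalized B-basis of $\mathbb{S}_n^{\alpha,\beta}$. Then the matrix form of the linear transformation that maps $\mathcal{B}_n^{\alpha,\beta}$ to $\mathcal{F}_n^{\alpha,\beta}$ is $$\left[\varphi_{n,i}(u)\right]_{i=0}^{n}=\left[t_{i,j}^{n}\right]_{i=0,\,j=0}^{n,\,n}\cdot\left[b_{n,i}(u)\right]_{i=0}^{n},\quad \forall u\in[\alpha,\beta],$$ where $t_{0,j}^{n}=1$ for $j=0,1,\ldots,n$; $t_{i,0}^{n}=\varphi_{n,i}(\alpha)$ and $t_{i,n}^{n}=\varphi_{n,i}(\beta)$ for $i=0,1,\ldots,n$; while for all $i=1,2,\ldots,n$ and $j=1,2,\ldots,\lfloor n/2\rfloor$ $$t_{i,j}^{n}=\varphi_{n,i}(\alpha)-\frac{1}{b_{n,j}^{(j)}(\alpha)}\sum_{r=1}^{j-1}\frac{\varphi_{n,i}^{(r)}(\alpha)}{b_{n,r}^{(r)}(\alpha)}\left(b_{n,r}^{(j)}(\alpha)+\sum_{\ell=1}^{j-r-1}(-1)^{\ell}\sum_{r<k_1<k_2<\cdots<k_\ell<j}\frac{b_{n,r}^{(k_1)}(\alpha)\,b_{n,k_1}^{(k_2)}(\alpha)\,b_{n,k_2}^{(k_3)}(\alpha)\cdots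 b_{n,k_{\ell-1}}^{(k_\ell)}(\alpha)\,b_{n,k_\ell}^{(j)}(\alpha)}{b_{n,k_1}^{(k_1)}(\alpha)\,b_{n,k_2}^{(k_2)}(\alpha)\cdots b_{n,k_\ell}^{(k_\ell)}(\alpha)}\right)+\frac{\varphi_{n,i}^{(j)}(\alpha)}{b_{n,j}^{(j)}(\alpha)}$$ and $$t_{i,n-j}^{n}=\varphi_{n,i}(\beta)-\frac{1}{b_{n,n-j}^{(j)}(\beta)}\sum_{r=1}^{j-1}\frac{\varphi_{n,i}^{(r)}(\beta)}{b_{n,n-r}^{(r)}(\beta)}\left(b_{n,n-r}^{(j)}(\beta)+\sum_{\ell=1}^{j-r-1}(-1)^{\ell}\sum_{r<k_1<k_2<\cdots<k_\ell<j}\frac{b_{n,n-r}^{(k_1)}(\beta)\,b_{n,n-k_1}^{(k_2)}(\beta)\,b_{n,n-k_2}^{(k_3)}(\beta)\cdots b_{n,n-k_{\ell-1}}^{(k_\ell)}(\beta)\,b_{n,n-k_\ell}^{(j)}(\beta)}{b_{n,n-k_1}^{(k_1)}(\beta)\,b_{n,n-k_2}^{(k_2)}(\beta)\cdots b_{n,n-k_\ell}^{(k_\ell)}(\beta)}\right)+\frac{\varphi_{n,i}^{(j)}(\beta)}{b_{n,n-j}^{(j)}(\beta)}.$$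
   Context: Here $-\infty<\alpha<\beta<\infty$. A system $\mathcal{F}_n^{\alpha,\beta}=\{\varphi_{n,i}:[\alpha,\beta]\to\mathbb{R}\}_{i=0}^n\subset C^n([\alpha,\beta])$ is an extended Chebyshev (EC) system if for every $0\le r\le n$, all knots $\alpha\le u_0<\cdots<u_r\le\beta$, all positive integers $m_0,\dots,m_r$ with $\sum_k m_k=n+1$, and all reals $\xi_{k,\ell}$, there is a unique $f\in\mathbb{S}_n^{\alpha,\beta}:=\operatorname{span}\mathcal{F}_n^{\alpha,\beta}$ with $f^{(\ell)}(u_k)=\xi_{k,\ell}$ for $\ell=0,\ldots,m_k-1$, $k=0,\ldots,r$. It is assumed throughout that the determinants of the coefficient matrices of these Hermite interpolation problems are strictly positive, and that $\varphi_{n,0}\equiv1$. $\mathcal{F}_n^{\alpha,\beta}$ is called the ordinary basis of $\mathbb{S}_n^{\alpha,\beta}$. The space $\mathbb{S}_n^{\alpha,\beta}$ has a unique non-negative normalized B-basis $\mathcal{B}_n^{\alpha,\beta}=\{b_{n,i}\}_{i=0}^n$ (standing fact of the paper, taken from the literature). It is a basis of $\mathbb{S}_n^{\alpha,\beta}$ consisting of non-negative functions on $[\alpha,\beta]$ that satisfies: $\sum_{i=0}^n b_{n,i}(u)=1$ for all $u\in[\alpha,\beta]$; $b_{n,0}(\alpha)=b_{n,n}(\beta)=1$; for every $i$, $b_{n,i}^{(j)}(\alpha)=0$ for $j=0,\ldots,i-1$ and $b_{n,i}^{(i)}(\alpha)>0$; and $b_{n,i}^{(j)}(\beta)=0$ for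 $j=0,\ldots,n-1-i$ and $(-1)^{n-i}b_{n,i}^{(n-i)}(\beta)>0$. Convention: empty sums equal $0$; in particular, if for some $\ell$ there are no integers $k_1,\ldots,k_\ell$ with $r<k_1<\cdots<k_\ell<j$, the corresponding sum is $0$. If $n=2z$ is even, the middle column $j=z$ is given by either formula (both give the same value). The notation $[\cdot]_{i=0}^n$ denotes a column vector. *)

theory Defs
  imports "HOL-Analysis.Derivative" "Jordan_Normal_Form.Determinant"
begin

text \<open>Functions on $[a,b]$ are represented by total functions of which only the values on
  \<open>{a..b}\<close> matter.  Derivatives are taken within \<open>{a..b}\<close>, hence are one-sided at the end points.\<close>

fun deriv_on :: "real \<Rightarrow> real \<Rightarrow> nat \<Rightarrow> (real \<Rightarrow> real) \<Rightarrow> real \<Rightarrow> real" where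
  "deriv_on a b 0 f = f"
| "deriv_on a b (Suc k) f = (\<lambda>x. vector_derivative (deriv_on a b k f) (at x within {a..b}))"

definition Cn_on :: "real \<Rightarrow> real \<Rightarrow> nat \<Rightarrow> (real \<Rightarrow> real) \<Rightarrow> bool" where
  "Cn_on a b n f \<longleftrightarrow>
     (\<forall>k<n. deriv_on a b k f differentiable_on {a..b}) \<and> continuous_on {a..b} (deriv_on a b n f)"

text \<open>The span consists of functions normalised to be \<open>undefined\<close> outside \<open>{a..b}\<close>, so that
  equality of its elements is equality on \<open>{a..b}\<close>.\<close>

definition span_on :: "real \<Rightarrow> real \<Rightarrow> nat \<Rightarrow> (nat \<Rightarrow> real \<Rightarrow> real) \<Rightarrow> (real \<Rightarrow> real) set" where
  "span_on a b n \<phi> = {restrict (\<lambda>x. \<Sum>i\<le>n. c i * \<phi> i x) {a..b} | c. True}"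

definition hermite_nodes ::
  "real \<Rightarrow> real \<Rightarrow> nat \<Rightarrow> nat \<Rightarrow> (nat \<Rightarrow> real) \<Rightarrow> (nat \<Rightarrow> nat) \<Rightarrow> bool" where
  "hermite_nodes a b n r u m \<longleftrightarrow>
     r \<le> n \<and> strict_mono_on {..r} u \<and> u ` {..r} \<subseteq> {a..b} \<and>
     (\<forall>k\<le>r. 0 < m k) \<and> (\<Sum>k\<le>r. m k) = n + 1"

definition EC_system :: "real \<Rightarrow> real \<Rightarrow> nat \<Rightarrow> (nat \<Rightarrow> real \<Rightarrow> real) \<Rightarrow> bool" where
  "EC_system a b n \<phi> \<longleftrightarrow>
     (\<forall>i\<le>n. Cn_on a b n (\<phi> i)) \<and>
     (\<forall>r u m (\<xi> :: nat \<Rightarrow> nat \<Rightarrow> real). hermite_nodes a b n r u m \<longrightarrow>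
        (\<exists>!f. f \<in> span_on a b n \<phi> \<and> (\<forall>k\<le>r. \<forall>l<m k. deriv_on a b l f (u k) = \<xi> k l)))"

text \<open>The Hermite conditions $(k,l)$, $k \le r$, $l < m_k$, in lexicographic order; they index the
  rows of the coefficient matrix, whose columns are indexed by the functions of the system.\<close>

definition hermite_conds :: "nat \<Rightarrow> (nat \<Rightarrow> nat) \<Rightarrow> (nat \<times> nat) list" where
  "hermite_conds r m = [(k, l). k \<leftarrow> [0..<Suc r], l \<leftarrow> [0..<m k]]"

definition hermite_mat ::
  "real \<Rightarrow> real \<Rightarrow> nat \<Rightarrow> (nat \<Rightarrow> real \<Rightarrow> real) \<Rightarrow> nat \<Rightarrow> (nat \<Rightarrow> real) \<Rightarrow> (nat \<Rightarrow> nat) \<Rightarrow> real mat" where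
  "hermite_mat a b n \<phi> r u m =
     mat (n + 1) (n + 1)
       (\<lambda>(p, i). case hermite_conds r m ! p of (k, l) \<Rightarrow> deriv_on a b l (\<phi> i) (u k))"

definition positive_hermite_dets :: "real \<Rightarrow> real \<Rightarrow> nat \<Rightarrow> (nat \<Rightarrow> real \<Rightarrow> real) \<Rightarrow> bool" where
  "positive_hermite_dets a b n \<phi> \<longleftrightarrow>
     (\<forall>r u m. hermite_nodes a b n r u m \<longrightarrow> 0 < Determinant.det (hermite_mat a b n \<phi> r u m))"

definition basis_on ::
  "real \<Rightarrow> real \<Rightarrow> nat \<Rightarrow> (nat \<Rightarrow> real \<Rightarrow> real) \<Rightarrow> (real \<Rightarrow> real) set \<Rightarrow> bool" where
  "basis_on a b n B S \<longleftrightarrow>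
     span_on a b n B = S \<and>
     (\<forall>c. (\<forall>x\<in>{a..b}. (\<Sum>i\<le>n. c i * B i x) = 0) \<longrightarrow> (\<forall>i\<le>n. c i = 0))"

definition normalized_B_basis ::
  "real \<Rightarrow> real \<Rightarrow> nat \<Rightarrow> (nat \<Rightarrow> real \<Rightarrow> real) \<Rightarrow> (real \<Rightarrow> real) set \<Rightarrow> bool" where
  "normalized_B_basis a b n B S \<longleftrightarrow>
     basis_on a b n B S \<and>
     (\<forall>i\<le>n. \<forall>x\<in>{a..b}. 0 \<le> B i x) \<and>
     (\<forall>x\<in>{a..b}. (\<Sum>i\<le>n. B i x) = 1) \<and>
     B 0 a = 1 \<and> B n b = 1 \<and>
     (\<forall>i\<le>n. (\<forall>j<i. deriv_on a b j (B i) a = 0) \<and> 0 < deriv_on a b i (B i) a) \<and>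
     (\<forall>i\<le>n. (\<forall>j<n - i. deriv_on a b j (B i) b = 0) \<and>
             0 < (- 1) ^ (n - i) * deriv_on a b (n - i) (B i) b)"

text \<open>Increasing tuples $r < k_1 < \dots < k_l < j$ are represented by lists.  Below, \<open>M p q\<close>
  stands for $b_{n,p}^{(q)}(\alpha)$, respectively $b_{n,n-p}^{(q)}(\beta)$; the numerator of each
  summand is the product of \<open>M\<close> over consecutive entries of $r, k_1, \dots, k_l, j$.\<close>

definition chains :: "nat \<Rightarrow> nat \<Rightarrow> nat \<Rightarrow> nat list set" where
  "chains l r j = {ks. length ks = l \<and> sorted_wrt (<) ks \<and> set ks \<subseteq> {r<..<j}}"

definition chain_term :: "(nat \<Rightarrow> nat \<Rightarrow> real) \<Rightarrow> nat \<Rightarrow> nat \<Rightarrow> nat list \<Rightarrow> real" where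
  "chain_term M r j ks =
     (let xs = r # ks @ [j] in
       (\<Prod>p\<le>length ks. M (xs ! p) (xs ! Suc p)) / (\<Prod>p<length ks. M (ks ! p) (ks ! p)))"

definition chain_sum :: "(nat \<Rightarrow> nat \<Rightarrow> real) \<Rightarrow> nat \<Rightarrow> nat \<Rightarrow> real" where
  "chain_sum M r j = (\<Sum>l=1..j - r - 1. (- 1) ^ l * (\<Sum>ks\<in>chains l r j. chain_term M r j ks))"

end

theory Submission
  imports Defs
begin

text \<open>
  Write \<open>\<phi> i = (\<Sum>p\<le>n. t i p * B p)\<close>.  Since \<open>\<phi> 0\<close> and the sum of all \<open>B p\<close> are both the constant
  \<open>1\<close>, linear independence makes the first row of \<open>t\<close> constant.  All the other entries are read
  off from the derivatives at one end point, say at \<open>\<alpha>\<close>.  Let \<open>M p q\<close> be the \<open>q\<close>-th derivative of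
  \<open>B p\<close> at \<open>\<alpha>\<close>.  The vanishing orders of the B-basis say that \<open>M\<close> is triangular with nonzero
  diagonal, and differentiating the partition of unity gives \<open>(\<Sum>p\<le>n. M p q) = 0\<close> for \<open>q \<ge> 1\<close>.
  Subtracting \<open>t i 0 = \<phi> i \<alpha>\<close> times this identity from the \<open>q\<close>-th derivative of the expansion
  eliminates the row \<open>p = 0\<close>, and the differences \<open>s p = t i p - t i 0\<close> solve the
  triangular system \<open>\<phi> i\<^sup>(\<^sup>q\<^sup>)(\<alpha>) = (\<Sum>p=1..q. s p * M p q)\<close>.

  The alternating sums over chains \<open>r < k\<^sub>1 < \<dots> < k\<^sub>l < j\<close> are what forward substitution produces
  (lemma \<open>triangular_system_solution\<close>): expanding the inverse of a triangular matrix as a finite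
  Neumann series in its off-diagonal part yields one summand for every chain.  The substitution
  sees the chains only through the recursion \<open>chain_coeff_rec\<close>, which splits off their last
  element.

  At \<open>\<beta>\<close> the vanishing orders are those of the reversed family \<open>B (n - p)\<close>, so the same
  argument (lemma \<open>endpoint_coordinates\<close>) applies to that family.  It yields both formulas for all
  \<open>j\<close> from \<open>1\<close> to \<open>n\<close>, hence in particular for those up to \<open>n div 2\<close>; it also shows that they
  agree where they overlap, both being coordinates in the same basis.
\<close>

section \<open>Iterated one-sided derivatives\<close>

text \<open>Derivatives are taken within the interval, so values outside it are irrelevant.  This is what
  allows passing between a function and its restriction in the span.\<close>

lemma deriv_on_cong:
  assumes "\<And>x. x \<in> {a..b} \<Longrightarrow> f x = g x" and "x \<in> {a..b}"
  shows "deriv_on a b k f x = deriv_on a b k g x"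
  using assms(2)
proof (induction k arbitrary: x)
  case 0
  then show ?case using assms(1) by simp
next
  case (Suc k)
  have "(deriv_on a b k f has_vector_derivative d) (at x within {a..b}) \<longleftrightarrow>
        (deriv_on a b k g has_vector_derivative d) (at x within {a..b})" for d
    using has_vector_derivative_transform[OF Suc.prems, of "deriv_on a b k f" "deriv_on a b k g" d]
      has_vector_derivative_transform[OF Suc.prems, of "deriv_on a b k g" "deriv_on a b k f" d]
      Suc.IH by metis
  then show ?case by (simp add: vector_derivative_def)
qed

lemma deriv_on_Suc_eqI:
  assumes "a < b" and "x \<in> {a..b}"
    and "(g has_vector_derivative d) (at x within {a..b})"
    and "\<And>y. y \<in> {a..b} \<Longrightarrow> deriv_on a b k f y = g y"
  shows "deriv_on a b (Suc k) f x = d"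
proof -
  have "(deriv_on a b k f has_vector_derivative d) (at x within {a..b})"
    using has_vector_derivative_transform[OF assms(2) assms(4) assms(3)] .
  then show ?thesis
    using assms(1,2) by (simp add: vector_derivative_within_closed_interval)
qed

lemma deriv_on_const_Suc:
  assumes "a < b" and "x \<in> {a..b}"
  shows "deriv_on a b (Suc k) (\<lambda>_. c) x = 0"
  using assms(2)
proof (induction k arbitrary: x)
  case 0
  show ?case
    by (rule deriv_on_Suc_eqI[OF assms(1) 0 has_vector_derivative_const]) simp
next
  case (Suc k)
  show ?case
    by (rule deriv_on_Suc_eqI[OF assms(1) Suc.prems has_vector_derivative_const]) (rule Suc.IH)
qed

lemma Cn_on_has_vector_derivative:
  assumes "Cn_on a b n f" and "k < n" and "x \<in> {a..b}"
  shows "(deriv_on a b k f has_vector_derivative deriv_on a b (Suc k) f x) (at x within {a..b})"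
  using assms by (auto simp: Cn_on_def differentiable_on_def vector_derivative_works)

lemma deriv_on_linear_combination:
  assumes "a < b" and "\<And>i. i \<in> I \<Longrightarrow> Cn_on a b n (f i)" and "k \<le> n" and "x \<in> {a..b}"
  shows "deriv_on a b k (\<lambda>x. \<Sum>i\<in>I. c i * f i x) x = (\<Sum>i\<in>I. c i * deriv_on a b k (f i) x)"
  using assms(3,4)
proof (induction k arbitrary: x)
  case 0
  then show ?case by simp
next
  case (Suc k)
  have "((\<lambda>y. \<Sum>i\<in>I. c i * deriv_on a b k (f i) y) has_vector_derivative
          (\<Sum>i\<in>I. c i * deriv_on a b (Suc k) (f i) x)) (at x within {a..b})"
  proof (rule has_vector_derivative_sum)
    fix i assume "i \<in> I"
    from Cn_on_has_vector_derivative[OF assms(2)[OF this], of k x] Suc.prems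
    show "((\<lambda>y. c i * deriv_on a b k (f i) y) has_vector_derivative
            c i * deriv_on a b (Suc k) (f i) x) (at x within {a..b})"
      by (intro has_vector_derivative_mult_right) auto
  qed
  from deriv_on_Suc_eqI[OF assms(1) Suc.prems(2) this] Suc.IH Suc.prems(1) show ?case
    by simp
qed

text \<open>The B-basis is only known to lie in the span; this transfers to it the smoothness of the
  system that spans it.\<close>

lemma Cn_on_linear_combination:
  assumes "a < b" and "\<And>i. i \<in> I \<Longrightarrow> Cn_on a b n (f i)"
    and "\<And>x. x \<in> {a..b} \<Longrightarrow> g x = (\<Sum>i\<in>I. c i * f i x)"
  shows "Cn_on a b n g"
proof -
  have eq: "deriv_on a b k g x = (\<Sum>i\<in>I. c i * deriv_on a b k (f i) x)"
    if "k \<le> n" "x \<in> {a..b}" for k x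
    using deriv_on_cong[OF assms(3) that(2)] deriv_on_linear_combination[OF assms(1,2) that]
    by simp
  have "deriv_on a b k g differentiable_on {a..b}" if "k < n" for k
  proof -
    have "(deriv_on a b k g has_vector_derivative
            (\<Sum>i\<in>I. c i * deriv_on a b (Suc k) (f i) x)) (at x within {a..b})"
      if x: "x \<in> {a..b}" for x
    proof (rule has_vector_derivative_transform[OF x])
      show "((\<lambda>y. \<Sum>i\<in>I. c i * deriv_on a b k (f i) y) has_vector_derivative
              (\<Sum>i\<in>I. c i * deriv_on a b (Suc k) (f i) x)) (at x within {a..b})"
        using Cn_on_has_vector_derivative[OF assms(2) \<open>k < n\<close> x]
        by (intro has_vector_derivative_sum has_vector_derivative_mult_right)
    qed (use eq \<open>k < n\<close> in auto)
    then show ?thesis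
      unfolding differentiable_on_def by (blast intro: differentiableI_vector)
  qed
  moreover have "continuous_on {a..b} (deriv_on a b n g)"
  proof -
    have "continuous_on {a..b} (\<lambda>x. \<Sum>i\<in>I. c i * deriv_on a b n (f i) x)"
      using assms(2) by (intro continuous_intros) (auto simp: Cn_on_def)
    then show ?thesis
      by (rule continuous_on_eq) (simp add: eq)
  qed
  ultimately show ?thesis by (simp add: Cn_on_def)
qed

section \<open>The chain sums as entries of an inverse triangular matrix\<close>

lemma finite_chains: "finite (chains l r j)"
  by (rule finite_subset[OF _ finite_lists_length_eq[of "{r<..<j}" l]])
    (auto simp: chains_def)

lemma chains_empty:
  assumes "j - r - 1 < l"
  shows "chains l r j = {}"
proof -
  have False if "ks \<in> chains l r j" for ks
  proof -
    have "distinct ks" "set ks \<subseteq> {r<..<j}" "length ks = l"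
      using that strict_sorted_iff[of ks] by (auto simp: chains_def)
    then have "l \<le> card {r<..<j}"
      using card_mono[of "{r<..<j}" "set ks"] by (simp add: distinct_card)
    then show False using assms by simp
  qed
  then show ?thesis by blast
qed

text \<open>A nonempty chain is a shorter chain ending at its own last element \<open>k\<close>, followed by the
  final step from \<open>k\<close> to \<open>j\<close>.  The lower end \<open>r\<close> stays fixed, which is the form that forward
  substitution needs.\<close>

lemma chains_Suc: "chains (Suc l) r j = (\<Union>k\<in>{r<..<j}. (\<lambda>ks. ks @ [k]) ` chains l r k)"
proof (intro equalityI subsetI)
  fix xs assume xs: "xs \<in> chains (Suc l) r j"
  then obtain ks k where "xs = ks @ [k]"
    by (cases xs rule: rev_cases) (auto simp: chains_def)
  with xs have "k \<in> {r<..<j}" "ks \<in> chains l r k"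
    by (auto simp: chains_def sorted_wrt_append)
  with \<open>xs = ks @ [k]\<close> show "xs \<in> (\<Union>k\<in>{r<..<j}. (\<lambda>ks. ks @ [k]) ` chains l r k)"
    by blast
next
  fix xs assume "xs \<in> (\<Union>k\<in>{r<..<j}. (\<lambda>ks. ks @ [k]) ` chains l r k)"
  then show "xs \<in> chains (Suc l) r j"
    by (force simp: chains_def sorted_wrt_append)
qed

lemma chain_term_Nil: "chain_term M r j [] = M r j"
  by (simp add: chain_term_def)

lemma chain_term_snoc: "chain_term M r j (ks @ [k]) = chain_term M r k ks * M k j / M k k"
proof -
  let ?xs = "r # ks @ [k]" and ?ys = "r # (ks @ [k]) @ [j]"
  have nth: "?ys ! p = ?xs ! p" if "p \<le> Suc (length ks)" for p
    using that nth_append[of ?xs "[j]" p] by simp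
  have "(\<Prod>p\<le>length ks. M (?ys ! p) (?ys ! Suc p)) = (\<Prod>p\<le>length ks. M (?xs ! p) (?xs ! Suc p))"
    by (intro prod.cong refl) (simp only: nth atMost_iff Suc_le_mono le_SucI)
  moreover have "?ys ! Suc (length ks) = k" "?ys ! Suc (Suc (length ks)) = j"
    by (simp_all add: nth_append)
  ultimately have num: "(\<Prod>p\<le>length (ks @ [k]). M (?ys ! p) (?ys ! Suc p)) =
      (\<Prod>p\<le>length ks. M (?xs ! p) (?xs ! Suc p)) * M k j"
    by simp
  have den: "(\<Prod>p<length (ks @ [k]). M ((ks @ [k]) ! p) ((ks @ [k]) ! p)) =
      (\<Prod>p<length ks. M (ks ! p) (ks ! p)) * M k k"
    by (simp add: nth_append)
  show ?thesis
    unfolding chain_term_def Let_def num den by simp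
qed

definition chain_level :: "(nat \<Rightarrow> nat \<Rightarrow> real) \<Rightarrow> nat \<Rightarrow> nat \<Rightarrow> nat \<Rightarrow> real" where
  "chain_level M l r j = (\<Sum>ks\<in>chains l r j. chain_term M r j ks)"

lemma chain_level_0: "chain_level M 0 r j = M r j"
proof -
  have "chains 0 r j = {[]}" by (auto simp: chains_def)
  then show ?thesis by (simp add: chain_level_def chain_term_Nil)
qed

lemma chain_level_Suc:
  "chain_level M (Suc l) r j = (\<Sum>k\<in>{r<..<j}. chain_level M l r k * M k j / M k k)"
proof -
  have "chain_level M (Suc l) r j =
      (\<Sum>k\<in>{r<..<j}. \<Sum>xs\<in>(\<lambda>ks. ks @ [k]) ` chains l r k. chain_term M r j xs)"
    unfolding chain_level_def chains_Suc
    by (rule sum.UNION_disjoint) (auto simp: finite_chains)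
  also have "\<dots> = (\<Sum>k\<in>{r<..<j}. \<Sum>ks\<in>chains l r k. chain_term M r k ks * M k j / M k k)"
  proof (rule sum.cong[OF refl])
    fix k
    have "inj_on (\<lambda>ks. ks @ [k]) (chains l r k)" by (simp add: inj_on_def)
    then show "(\<Sum>xs\<in>(\<lambda>ks. ks @ [k]) ` chains l r k. chain_term M r j xs) =
        (\<Sum>ks\<in>chains l r k. chain_term M r k ks * M k j / M k k)"
      by (simp only: sum.reindex o_def chain_term_snoc)
  qed
  finally show ?thesis
    by (simp add: chain_level_def sum_distrib_right sum_divide_distrib)
qed

text \<open>For \<open>r < j\<close>, this is \<open>- M r r * M j j\<close> times the entry \<open>(r, j)\<close> of the inverse of the
  triangular matrix \<open>M\<close>.\<close>

definition chain_coeff :: "(nat \<Rightarrow> nat \<Rightarrow> real) \<Rightarrow> nat \<Rightarrow> nat \<Rightarrow> real" where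
  "chain_coeff M r j = M r j + chain_sum M r j"

text \<open>There are no chains longer than \<open>j - r - 1\<close>, so the range of lengths may be extended at will.
  A common bound \<open>N\<close> for all intermediate end points lets the sums over lengths and over last
  elements be interchanged below.\<close>

lemma chain_coeff_eq_sum_levels:
  assumes "j - r - 1 \<le> N"
  shows "chain_coeff M r j = (\<Sum>l\<le>N. (- 1) ^ l * chain_level M l r j)"
proof -
  have "(\<Sum>l\<le>N. (- 1) ^ l * chain_level M l r j) =
      (\<Sum>l\<in>{0..j - r - 1}. (- 1) ^ l * chain_level M l r j)"
    using assms by (intro sum.mono_neutral_right) (auto simp: chain_level_def chains_empty)
  also have "\<dots> = M r j + (\<Sum>l=1..j - r - 1. (- 1) ^ l * chain_level M l r j)"
    by (subst sum.atLeast_Suc_atMost) (simp_all add: chain_level_0)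
  finally show ?thesis
    by (simp add: chain_coeff_def chain_sum_def chain_level_def)
qed

lemma chain_coeff_rec:
  assumes "r < j"
  shows "chain_coeff M r j = M r j - (\<Sum>k\<in>{r<..<j}. chain_coeff M r k * M k j / M k k)"
proof -
  obtain N where N: "j = Suc N" using assms by (cases j) auto
  have "chain_coeff M r j = (\<Sum>l\<le>Suc N. (- 1) ^ l * chain_level M l r j)"
    by (rule chain_coeff_eq_sum_levels) (simp add: N)
  also have "\<dots> = M r j + (\<Sum>l\<le>N. (- 1) ^ Suc l * chain_level M (Suc l) r j)"
    by (subst sum.atMost_Suc_shift) (simp add: chain_level_0)
  also have "(\<Sum>l\<le>N. (- 1) ^ Suc l * chain_level M (Suc l) r j) =
      - (\<Sum>l\<le>N. \<Sum>k\<in>{r<..<j}. (- 1) ^ l * chain_level M l r k * (M k j / M k k))"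
    by (simp add: chain_level_Suc sum_distrib_left sum_negf mult.assoc)
  also have "\<dots> = - (\<Sum>k\<in>{r<..<j}. (\<Sum>l\<le>N. (- 1) ^ l * chain_level M l r k) * (M k j / M k k))"
    by (subst sum.swap) (simp only: sum_distrib_right)
  also have "\<dots> = - (\<Sum>k\<in>{r<..<j}. chain_coeff M r k * (M k j / M k k))"
  proof -
    have "(\<Sum>l\<le>N. (- 1) ^ l * chain_level M l r k) = chain_coeff M r k" if "k \<in> {r<..<j}" for k
      using that N by (intro chain_coeff_eq_sum_levels[symmetric]) auto
    then show ?thesis by (intro arg_cong[of _ _ uminus] sum.cong refl) (simp only:)
  qed
  finally show ?thesis by simp
qed

text \<open>Forward substitution: inserting the solved \<open>s k\<close>, \<open>k < j\<close>, into equation \<open>j\<close> and collecting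
  the coefficient of each \<open>f r\<close> produces exactly the right-hand side of the recursion for
  \<open>chain_coeff M r j\<close>.\<close>

lemma triangular_system_solution:
  fixes M :: "nat \<Rightarrow> nat \<Rightarrow> real"
  assumes diag: "\<And>q. q \<in> {1..n} \<Longrightarrow> M q q \<noteq> 0"
    and sys: "\<And>q. q \<in> {1..n} \<Longrightarrow> f q = (\<Sum>p=1..q. s p * M p q)"
    and "j \<in> {1..n}"
  shows "s j = (f j - (\<Sum>r=1..j - 1. f r / M r r * chain_coeff M r j)) / M j j"
  using \<open>j \<in> {1..n}\<close>
proof (induction j rule: less_induct)
  case (less j)
  have ivl: "{1..j} = insert j {1..<j}" "{1..j - 1} = {1..<j}"
    using less.prems by auto
  have IH: "s k = f k / M k k - (\<Sum>r\<in>{1..<k}. f r / M r r * chain_coeff M r k) / M k k"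
    if "k \<in> {1..<j}" for k
  proof -
    have "{1..k - 1} = {1..<k}" using that by auto
    with less.IH[of k] that less.prems show ?thesis by (simp add: diff_divide_distrib)
  qed
  have swap: "(\<Sum>k\<in>{1..<j}. \<Sum>r\<in>{1..<k}. g r k) = (\<Sum>r\<in>{1..<j}. \<Sum>k\<in>{r<..<j}. g r k)"
    for g :: "nat \<Rightarrow> nat \<Rightarrow> real"
    by (simp add: sum.Sigma)
      (rule sum.reindex_bij_witness[of _ prod.swap prod.swap], auto)
  have "(\<Sum>k\<in>{1..<j}. s k * M k j) =
      (\<Sum>k\<in>{1..<j}. f k / M k k * M k j
          - (\<Sum>r\<in>{1..<k}. f r / M r r * (chain_coeff M r k * M k j / M k k)))"
    by (intro sum.cong refl) (simp only: IH left_diff_distrib sum_distrib_right sum_divide_distrib times_divide_eq_left times_divide_eq_right mult.assoc)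
  also have "\<dots> = (\<Sum>r\<in>{1..<j}. f r / M r r *
      (M r j - (\<Sum>k\<in>{r<..<j}. chain_coeff M r k * M k j / M k k)))"
    by (simp only: sum_subtractf swap right_diff_distrib sum_distrib_left)
  also have "\<dots> = (\<Sum>r\<in>{1..<j}. f r / M r r * chain_coeff M r j)"
    by (intro sum.cong refl) (simp add: chain_coeff_rec)
  finally have "f j = s j * M j j + (\<Sum>r\<in>{1..<j}. f r / M r r * chain_coeff M r j)"
    using sys[OF less.prems] by (simp add: ivl(1) del: One_nat_def)
  then show ?case
    using diag[OF less.prems] unfolding ivl(2) by simp
qed

section \<open>Coordinates read off at an end point\<close>

text \<open>The equation for \<open>q = 0\<close> determines \<open>t 0\<close> by itself; the vanishing column sums then turn the
  remaining equations into a triangular system for \<open>t p - t 0\<close>, \<open>p \<ge> 1\<close>.\<close>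

lemma coordinates_from_derivatives:
  fixes M :: "nat \<Rightarrow> nat \<Rightarrow> real"
  assumes tri: "\<And>p q. p \<le> n \<Longrightarrow> q < p \<Longrightarrow> M p q = 0"
    and diag: "\<And>q. q \<le> n \<Longrightarrow> M q q \<noteq> 0" and corner: "M 0 0 = 1"
    and cols: "\<And>q. q \<in> {1..n} \<Longrightarrow> (\<Sum>p\<le>n. M p q) = 0"
    and sys: "\<And>q. q \<le> n \<Longrightarrow> f q = (\<Sum>p\<le>n. t p * M p q)"
  shows "t 0 = f 0"
    and "j \<in> {1..n} \<Longrightarrow>
      t j = f 0 - 1 / M j j * (\<Sum>r=1..j - 1. f r / M r r * (M r j + chain_sum M r j)) + f j / M j j"
proof -
  have "f 0 = (\<Sum>p\<in>{0}. t p * M p 0)"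
    unfolding sys[of 0, simplified] by (rule sum.mono_neutral_right) (auto simp: tri)
  then show t0: "t 0 = f 0" by (simp add: corner)
  assume j: "j \<in> {1..n}"
  have "f q = (\<Sum>p=1..q. (t p - t 0) * M p q)" if q: "q \<in> {1..n}" for q
  proof -
    have "f q = (\<Sum>p\<le>n. t p * M p q) - t 0 * (\<Sum>p\<le>n. M p q)"
      using sys[of q] cols[OF q] q by simp
    also have "\<dots> = (\<Sum>p\<le>n. (t p - t 0) * M p q)"
      by (simp add: sum_distrib_left sum_subtractf left_diff_distrib)
    also have "\<dots> = (\<Sum>p=1..q. (t p - t 0) * M p q)"
    proof (rule sum.mono_neutral_right)
      show "\<forall>p\<in>{..n} - {1..q}. (t p - t 0) * M p q = 0"
      proof
        fix p assume "p \<in> {..n} - {1..q}"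
        then have "p = 0 \<or> p \<le> n \<and> q < p" by auto
        then show "(t p - t 0) * M p q = 0" by (auto simp: tri)
      qed
    qed (use q in auto)
    finally show ?thesis .
  qed
  from triangular_system_solution[OF _ this j] diag
  have "t j - t 0 = (f j - (\<Sum>r=1..j - 1. f r / M r r * chain_coeff M r j)) / M j j"
    by simp
  then show "t j = f 0 - 1 / M j j * (\<Sum>r=1..j - 1. f r / M r r * (M r j + chain_sum M r j))
      + f j / M j j"
    by (simp add: t0 diff_divide_distrib chain_coeff_def)
qed

text \<open>Stated for a point \<open>x\<close> of the interval at which \<open>B p\<close> vanishes to order exactly \<open>p\<close>: at \<open>\<alpha>\<close>
  this is the B-basis itself, at \<open>\<beta>\<close> the B-basis in reverse order.\<close>

lemma endpoint_coordinates:
  fixes B :: "nat \<Rightarrow> real \<Rightarrow> real"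
  assumes "a < b" and x: "x \<in> {a..b}"
    and smooth: "\<And>p. p \<le> n \<Longrightarrow> Cn_on a b n (B p)"
    and one: "\<And>y. y \<in> {a..b} \<Longrightarrow> (\<Sum>p\<le>n. B p y) = 1"
    and vanish: "\<And>p q. p \<le> n \<Longrightarrow> q < p \<Longrightarrow> deriv_on a b q (B p) x = 0"
    and diag: "\<And>q. q \<le> n \<Longrightarrow> deriv_on a b q (B q) x \<noteq> 0"
    and corner: "B 0 x = 1"
    and f: "\<And>y. y \<in> {a..b} \<Longrightarrow> f y = (\<Sum>p\<le>n. t p * B p y)"
  shows "t 0 = f x"
    and "j \<in> {1..n} \<Longrightarrow>
      t j = f x - 1 / deriv_on a b j (B j) x *
          (\<Sum>r=1..j - 1. deriv_on a b r f x / deriv_on a b r (B r) x *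
            (deriv_on a b j (B r) x + chain_sum (\<lambda>p q. deriv_on a b q (B p) x) r j))
        + deriv_on a b j f x / deriv_on a b j (B j) x"
proof -
  let ?M = "\<lambda>p q. deriv_on a b q (B p) x"
  have lin: "deriv_on a b q g x = (\<Sum>p\<le>n. c p * ?M p q)"
    if "q \<le> n" and "\<And>y. y \<in> {a..b} \<Longrightarrow> g y = (\<Sum>p\<le>n. c p * B p y)" for g c q
    using deriv_on_cong[OF that(2) x, where k = q] smooth
      deriv_on_linear_combination[OF \<open>a < b\<close> _ that(1) x, of "{..n}" B c] by simp
  have cols: "(\<Sum>p\<le>n. ?M p q) = 0" if "q \<in> {1..n}" for q
  proof -
    have "(\<Sum>p\<le>n. ?M p q) = deriv_on a b q (\<lambda>_. 1) x"
      using lin[of q "\<lambda>_. 1" "\<lambda>_. 1"] that one by simp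
    also have "\<dots> = 0"
      using deriv_on_const_Suc[OF \<open>a < b\<close> x, of "q - 1" 1] that by (cases q) auto
    finally show ?thesis .
  qed
  have sys: "deriv_on a b q f x = (\<Sum>p\<le>n. t p * ?M p q)" if "q \<le> n" for q
    using lin[OF that f] .
  have c: "?M 0 0 = 1" using corner by simp
  note main = coordinates_from_derivatives[where M = ?M and n = n and t = t
      and f = "\<lambda>q. deriv_on a b q f x", OF vanish diag c cols sys]
  show "t 0 = f x"
    using main(1) by simp
  show "t j = f x - 1 / deriv_on a b j (B j) x *
          (\<Sum>r=1..j - 1. deriv_on a b r f x / deriv_on a b r (B r) x *
            (deriv_on a b j (B r) x + chain_sum (\<lambda>p q. deriv_on a b q (B p) x) r j))
        + deriv_on a b j f x / deriv_on a b j (B j) x" if "j \<in> {1..n}"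
    using main(2)[OF _ _ _ _ _ that] by simp
qed

lemma in_span_onD:
  assumes "restrict g {a..b} \<in> span_on a b n f"
  obtains c where "\<And>x. x \<in> {a..b} \<Longrightarrow> g x = (\<Sum>i\<le>n. c i * f i x)"
proof -
  from assms obtain c where c: "restrict g {a..b} = restrict (\<lambda>x. \<Sum>i\<le>n. c i * f i x) {a..b}"
    by (auto simp: span_on_def)
  have "g x = (\<Sum>i\<le>n. c i * f i x)" if "x \<in> {a..b}" for x
    using fun_cong[OF c, of x] that by simp
  then show ?thesis using that by blast
qed

lemma member_in_span_on:
  assumes "k \<le> n"
  shows "restrict (f k) {a..b} \<in> span_on a b n f"
proof -
  have "(\<Sum>i\<le>n. (if i = k then 1 else 0) * f i x) = f k x" for x
    using assms by (simp add: if_distrib[of "\<lambda>z. z * _"] sum.delta cong: if_cong)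
  then have "restrict (f k) {a..b} = restrict (\<lambda>x. \<Sum>i\<le>n. (if i = k then 1 else 0) * f i x) {a..b}"
    by simp
  then show ?thesis unfolding span_on_def
    by (intro CollectI exI[of _ "\<lambda>i. if i = k then 1 else 0"]) simp
qed

section \<open>The transformation matrix\<close>

theorem theorem2p1:
  fixes \<alpha> \<beta> :: real and n :: nat and \<phi> B :: "nat \<Rightarrow> real \<Rightarrow> real"
  assumes "\<alpha> < \<beta>" and "1 \<le> n"
    and "EC_system \<alpha> \<beta> n \<phi>"
    and "positive_hermite_dets \<alpha> \<beta> n \<phi>"
    and "\<forall>u\<in>{\<alpha>..\<beta>}. \<phi> 0 u = 1"
    and "normalized_B_basis \<alpha> \<beta> n B (span_on \<alpha> \<beta> n \<phi>)"
  shows "\<exists>T \<in> carrier_mat (n + 1) (n + 1).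
     (\<forall>u\<in>{\<alpha>..\<beta>}.
        Matrix.vec (n + 1) (\<lambda>i. \<phi> i u) = T *\<^sub>v Matrix.vec (n + 1) (\<lambda>i. B i u)) \<and>
     (\<forall>j\<le>n. T $$ (0, j) = 1) \<and>
     (\<forall>i\<le>n. T $$ (i, 0) = \<phi> i \<alpha> \<and> T $$ (i, n) = \<phi> i \<beta>) \<and>
     (\<forall>i\<in>{1..n}. \<forall>j\<in>{1..n div 2}.
        T $$ (i, j) =
          \<phi> i \<alpha>
          - 1 / deriv_on \<alpha> \<beta> j (B j) \<alpha> *
            (\<Sum>r=1..j - 1. deriv_on \<alpha> \<beta> r (\<phi> i) \<alpha> / deriv_on \<alpha> \<beta> r (B r) \<alpha> *
               (deriv_on \<alpha> \<beta> j (B r) \<alpha>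
                + chain_sum (\<lambda>p q. deriv_on \<alpha> \<beta> q (B p) \<alpha>) r j))
          + deriv_on \<alpha> \<beta> j (\<phi> i) \<alpha> / deriv_on \<alpha> \<beta> j (B j) \<alpha> \<and>
        T $$ (i, n - j) =
          \<phi> i \<beta>
          - 1 / deriv_on \<alpha> \<beta> j (B (n - j)) \<beta> *
            (\<Sum>r=1..j - 1. deriv_on \<alpha> \<beta> r (\<phi> i) \<beta> / deriv_on \<alpha> \<beta> r (B (n - r)) \<beta> *
               (deriv_on \<alpha> \<beta> j (B (n - r)) \<beta>
                + chain_sum (\<lambda>p q. deriv_on \<alpha> \<beta> q (B (n - p)) \<beta>) r j))
          + deriv_on \<alpha> \<beta> j (\<phi> i) \<beta> / deriv_on \<alpha> \<beta> j (B (n - j)) \<beta>)"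
proof -
  let ?S = "span_on \<alpha> \<beta> n \<phi>"
  note basis = assms(6)[unfolded normalized_B_basis_def basis_on_def]
  have span: "span_on \<alpha> \<beta> n B = ?S"
    using basis by simp
  have indep: "c i = 0" if "\<forall>x\<in>{\<alpha>..\<beta>}. (\<Sum>i\<le>n. c i * B i x) = 0" "i \<le> n" for c i
    using basis that by blast
  have one: "(\<Sum>i\<le>n. B i x) = 1" if "x \<in> {\<alpha>..\<beta>}" for x
    using basis that by blast
  have corners: "B 0 \<alpha> = 1" "B n \<beta> = 1"
    using basis by simp_all
  have left_vanish: "deriv_on \<alpha> \<beta> q (B p) \<alpha> = 0" if "p \<le> n" "q < p" for p q
    using basis that by blast
  have left_diag: "deriv_on \<alpha> \<beta> q (B q) \<alpha> \<noteq> 0" if "q \<le> n" for q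
  proof -
    have "0 < deriv_on \<alpha> \<beta> q (B q) \<alpha>" using basis that by blast
    then show ?thesis by simp
  qed
  have right_vanish: "deriv_on \<alpha> \<beta> q (B (n - p)) \<beta> = 0" if "p \<le> n" "q < p" for p q
  proof -
    have "n - p \<le> n" "q < n - (n - p)" using that by auto
    then show ?thesis using basis by blast
  qed
  have right_diag: "deriv_on \<alpha> \<beta> q (B (n - q)) \<beta> \<noteq> 0" if "q \<le> n" for q
  proof -
    have "0 < (- 1) ^ (n - i) * deriv_on \<alpha> \<beta> (n - i) (B i) \<beta>" if "i \<le> n" for i
      using basis that by blast
    from this[of "n - q"] that show ?thesis by auto
  qed
  have ends: "\<alpha> \<in> {\<alpha>..\<beta>}" "\<beta> \<in> {\<alpha>..\<beta>}" using \<open>\<alpha> < \<beta>\<close> by auto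
  have smooth: "Cn_on \<alpha> \<beta> n (B p)" if p: "p \<le> n" for p
  proof -
    from member_in_span_on[OF p, of B \<alpha> \<beta>] span have "restrict (B p) {\<alpha>..\<beta>} \<in> ?S" by simp
    then obtain c where "\<And>x. x \<in> {\<alpha>..\<beta>} \<Longrightarrow> B p x = (\<Sum>i\<le>n. c i * \<phi> i x)"
      by (rule in_span_onD) blast
    with Cn_on_linear_combination[OF \<open>\<alpha> < \<beta>\<close>, of "{..n}" n \<phi> "B p" c] assms(3)
    show ?thesis by (simp add: EC_system_def)
  qed
  have "\<exists>c. \<forall>x\<in>{\<alpha>..\<beta>}. \<phi> i x = (\<Sum>j\<le>n. c j * B j x)" if i: "i \<le> n" for i
  proof -
    from member_in_span_on[OF i, of \<phi> \<alpha> \<beta>] span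
    have "restrict (\<phi> i) {\<alpha>..\<beta>} \<in> span_on \<alpha> \<beta> n B" by simp
    then obtain c where "\<And>x. x \<in> {\<alpha>..\<beta>} \<Longrightarrow> \<phi> i x = (\<Sum>j\<le>n. c j * B j x)"
      by (rule in_span_onD) blast
    then show ?thesis by blast
  qed
  then obtain t where t: "\<And>i x. i \<le> n \<Longrightarrow> x \<in> {\<alpha>..\<beta>} \<Longrightarrow> \<phi> i x = (\<Sum>j\<le>n. t i j * B j x)"
    by metis
  have t_rev: "\<phi> i x = (\<Sum>j\<le>n. t i (n - j) * B (n - j) x)" if "i \<le> n" "x \<in> {\<alpha>..\<beta>}" for i x
    using t[OF that] sum.nat_diff_reindex[of "\<lambda>j. t i j * B j x" "Suc n"]
    by (simp add: lessThan_Suc_atMost)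
  have one_rev: "(\<Sum>j\<le>n. B (n - j) x) = 1" if "x \<in> {\<alpha>..\<beta>}" for x
    using one[OF that] sum.nat_diff_reindex[of "\<lambda>j. B j x" "Suc n"]
    by (simp add: lessThan_Suc_atMost)
  have rev_smooth: "Cn_on \<alpha> \<beta> n (B (n - p))" if "p \<le> n" for p
    using smooth by simp
  have rev_corner: "B (n - 0) \<beta> = 1" using corners(2) by simp
  note at_left = endpoint_coordinates[where B = B and f = "\<phi> i" and t = "t i" for i,
      OF \<open>\<alpha> < \<beta>\<close> ends(1) smooth one left_vanish left_diag corners(1)]
  note at_right = endpoint_coordinates[where B = "\<lambda>p. B (n - p)" and f = "\<phi> i"
      and t = "\<lambda>j. t i (n - j)" for i,
      OF \<open>\<alpha> < \<beta>\<close> ends(2) rev_smooth one_rev right_vanish right_diag rev_corner]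
  have row0: "t 0 j = 1" if "j \<le> n" for j
  proof -
    have "(\<Sum>j\<le>n. (t 0 j - 1) * B j x) = 0" if "x \<in> {\<alpha>..\<beta>}" for x
    proof -
      have "(\<Sum>j\<le>n. (t 0 j - 1) * B j x) = (\<Sum>j\<le>n. t 0 j * B j x) - (\<Sum>j\<le>n. B j x)"
        by (simp add: left_diff_distrib sum_subtractf)
      also have "\<dots> = 0"
        using t[of 0 x] one[OF that] assms(5) that by simp
      finally show ?thesis .
    qed
    with indep[of "\<lambda>j. t 0 j - 1"] that show ?thesis by simp
  qed
  define T where "T = mat (n + 1) (n + 1) (\<lambda>(i, j). t i j)"
  have T: "T $$ (i, j) = t i j" if "i \<le> n" "j \<le> n" for i j
    using that by (simp add: T_def)
  have product: "Matrix.vec (n + 1) (\<lambda>i. \<phi> i u) = T *\<^sub>v Matrix.vec (n + 1) (\<lambda>i. B i u)"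
    if "u \<in> {\<alpha>..\<beta>}" for u
    using t[OF _ that]
    by (intro eq_vecI)
      (auto simp: T_def scalar_prod_def atLeast0LessThan lessThan_Suc_atMost)
  show ?thesis
  proof (intro bexI[of _ T] conjI ballI allI impI, goal_cases)
    case (1 u)
    then show ?case by (rule product)
  next
    case (2 j)
    then show ?case by (simp add: T row0)
  next
    case (3 i)
    then show ?case using at_left(1)[OF _ _ _ _ _ t[OF 3]] by (simp add: T)
  next
    case (4 i)
    then show ?case using at_right(1)[OF _ _ _ _ _ t_rev[OF 4]] by (simp add: T)
  next
    case (5 i j)
    then have "i \<le> n" "j \<in> {1..n}" by auto
    then show ?case using at_left(2)[OF _ _ _ _ _ t[OF \<open>i \<le> n\<close>] \<open>j \<in> {1..n}\<close>] by (simp add: T)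
  next
    case (6 i j)
    then have "i \<le> n" "j \<in> {1..n}" by auto
    then show ?case using at_right(2)[OF _ _ _ _ _ t_rev[OF \<open>i \<le> n\<close>] \<open>j \<in> {1..n}\<close>] by (simp add: T)
  next
    case 7
    show ?case by (simp add: T_def)
  qed
qed

end
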